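(* The set $\mathbb{R}\setminus\mathbb{Q}$ of irrational numbers is closed in $\mathbb{R}$ with respect to $\tilde d_R$; that is, if $(x_i)$ is a sequence of irrational numbers, $x\in\mathbb{R}$, and $\tilde d_R(x_i,x)\to0$, then $x$ is irrational.
   Context: Let $\mathbb{R}^\epsilon=\{a+b\epsilon:a,b\in\mathbb{R}\}$ be the two-dimensional real vector space with basis $\{1,\epsilon\}$, totally ordered by $a+b\epsilon<c+d\epsilon$ iff $a<c$, or $a=c$ and $b<d$; intervals in $\mathbb{R}^\epsilon$ are taken with respect to this order. An infinite hallway is a set $H=\bigcup_{i\ge 0}\{i\}\times(\mathbb{R}^\epsilon\setminus D_i)\subset\mathbb{R}\times\mathbb{R}^\epsilon$, where $D_i=(d_i,d_i+1)\subset\mathbb{R}^\epsilon$ with $d_i\in\mathbb{Z}$ for $i\ge 0$ (the $i$th doorway); it is assumed throughout that $D_0=(0,1)$. For $\alpha,\beta\in\mathbb{R}$ let $\ell_{\alpha\beta}=\{(x,\alpha x+\beta):x\in\mathbb{R}\}$ and $\ell^\epsilon_{\alpha\beta}=\{(x,\alpha x+\beta+t\epsilon):x,t\in\mathbb{R}\}$, and for $(x,y)\in\mathbb{R}\times\mathbb{R}^\epsilon$ let $\mathrm{proj}_\alpha(x,y)=y-\alpha x$. Define $\ell^\epsilon_{\alpha\beta}\vee H=\{a\in\mathbb{R}: a+b\epsilon\in \mathrm{proj}_\alpha(\ell^\epsilon_{\alpha\beta})\cap(\mathbb{R}^\epsilon\setminus\mathrm{proj}_\alpha(H))\text{ for some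 }b\in\mathbb{R}\}$; $\ell^\epsilon_{\alpha\beta}$ is a line of sight for $H$ if $\ell^\epsilon_{\alpha\beta}\vee H\neq\emptyset$. All lines of sight of a given infinite hallway $H$ that admits one have the same slope, denoted $s(H)$. For $\alpha\in\mathbb{R}$ let $s^{-1}(\alpha)$ be the set of infinite hallways admitting a line of sight of slope $\alpha$. Definition of $d_R$. For infinite hallways $H\ne H'$ with doorways $D_i=(d_i,d_i+1)$, $D_i'$, let $n=\min\{k: D_k\neq D_k'\}\ge 1$. The common initial segment $\mathrm{comm}(H,H')$ is the finite hallway with the shared doorways $D_0,\dots,D_{n-1}$; it admits a line of sight if there are $\alpha,\beta\in\mathbb{R}$ with $d_i<\alpha i+\beta<d_i+1$ for $0\le i\le n-1$. The unframed hallway $\bar H$ is obtained from $H$ by replacing each doorway $(d_i,d_i+1)$ by $[d_i,d_i+1]$; a real line $\ell_{\alpha\beta}$ is a line of sight for $\mathrm{comm}(\bar H,\bar H')$ if $d_i\le\alpha i+\beta\le d_i+1$ for $0\le i\le n-1$. Set $d_R(H,H)=0$; if $H\neq H'$ and $\mathrm{comm}(H,H')$ admits a line of sight, set $d_R(H,H')=\max\{\tfrac1q: q\in\mathbb{Z}_{>0},\ \ell_{\frac pq\beta}\text{ is a line of sight for }\mathrm{comm}(\bar H,\bar H')\text{ for some }\beta\in\mathbb{R},p\in\mathbb{Z}\}$; if $H\ne H'$ and $\mathrm{comm}(H,H')$ admits no line of sight, set $d_R(H,H')=\infty$. The induced distance on $\mathbb{R}$ is $\tilde d_R(\alpha,\gamma)=d_R(s^{-1}(\alpha),s^{-1}(\gamma))=\inf\{d_R(H,H'):H\in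 s^{-1}(\alpha),H'\in s^{-1}(\gamma)\}$. *)

theory Defs
  imports
    Complex_Main
    "HOL-Library.Product_Plus"
    "HOL-Library.Product_Lexorder"
    "HOL-Library.Extended_Nonnegative_Real"
begin

text \<open>
  The pair \<open>(a, b)\<close> stands for \<open>a + b \<epsilon>\<close>. Addition on pairs is componentwise and the order on
  pairs is the lexicographic one, so the interval notation below refers to that order.
\<close>

type_synonym real_eps = "real \<times> real"

definition embed :: "real \<Rightarrow> real_eps" where
  "embed a = (a, 0)"

text \<open>
  An infinite hallway is given by the sequence \<open>d\<close> of lower endpoints of its doorways; this loses
  nothing, see \<open>hallway_eq_iff\<close>.
\<close>

type_synonym doors = "nat \<Rightarrow> int"

definition doorway :: "doors \<Rightarrow> nat \<Rightarrow> real_eps set" where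
  "doorway d i = {embed (of_int (d i)) <..< embed (of_int (d i) + 1)}"

definition hallway :: "doors \<Rightarrow> (real \<times> real_eps) set" where
  "hallway d = (\<Union>i. {real i} \<times> (- doorway d i))"

definition infinite_hallways :: "doors set" where
  "infinite_hallways = {d. d 0 = 0}"

definition eps_line :: "real \<Rightarrow> real \<Rightarrow> (real \<times> real_eps) set" where
  "eps_line \<alpha> \<beta> = {(x, embed (\<alpha> * x + \<beta>) + (0, t)) | x t. True}"

definition proj :: "real \<Rightarrow> real \<times> real_eps \<Rightarrow> real_eps" where
  "proj \<alpha> = (\<lambda>(x, y). y - embed (\<alpha> * x))"

definition sight :: "real \<Rightarrow> real \<Rightarrow> (real \<times> real_eps) set \<Rightarrow> real set" where
  "sight \<alpha> \<beta> H = {a. \<exists>b. (a, b) \<in> proj \<alpha> ` eps_line \<alpha> \<beta> \<inter> (- (proj \<alpha> ` H))}"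

definition line_of_sight :: "real \<Rightarrow> real \<Rightarrow> (real \<times> real_eps) set \<Rightarrow> bool" where
  "line_of_sight \<alpha> \<beta> H \<longleftrightarrow> sight \<alpha> \<beta> H \<noteq> {}"

definition slope_hallways :: "real \<Rightarrow> doors set" where
  "slope_hallways \<alpha> = {d \<in> infinite_hallways. \<exists>\<beta>. line_of_sight \<alpha> \<beta> (hallway d)}"

text \<open>
  The number of shared initial doorways; the common initial segment consists of the doorways with
  index below it.
\<close>

definition comm_length :: "doors \<Rightarrow> doors \<Rightarrow> nat" where
  "comm_length d d' = (LEAST k. doorway d k \<noteq> doorway d' k)"

definition comm_line_of_sight :: "doors \<Rightarrow> doors \<Rightarrow> real \<Rightarrow> real \<Rightarrow> bool" where
  "comm_line_of_sight d d' \<alpha> \<beta> \<longleftrightarrow>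
     (\<forall>i < comm_length d d'.
        of_int (d i) < \<alpha> * real i + \<beta> \<and> \<alpha> * real i + \<beta> < of_int (d i) + 1)"

definition unframed_comm_line_of_sight :: "doors \<Rightarrow> doors \<Rightarrow> real \<Rightarrow> real \<Rightarrow> bool" where
  "unframed_comm_line_of_sight d d' \<alpha> \<beta> \<longleftrightarrow>
     (\<forall>i < comm_length d d'.
        of_int (d i) \<le> \<alpha> * real i + \<beta> \<and> \<alpha> * real i + \<beta> \<le> of_int (d i) + 1)"

definition reciprocals :: "doors \<Rightarrow> doors \<Rightarrow> real set" where
  "reciprocals d d' =
     {1 / of_int q | q :: int. q > 0 \<and>
        (\<exists>(p :: int) \<beta>. unframed_comm_line_of_sight d d' (of_int p / of_int q) \<beta>)}"

text \<open>
  The set \<open>reciprocals d d'\<close> may be infinite, so its maximum is expressed by \<open>GREATEST\<close> rather than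
  \<open>Max\<close>; it exists in the case where it is used, see \<open>reciprocals_greatest\<close>.
\<close>

definition dist_R :: "doors \<Rightarrow> doors \<Rightarrow> ennreal" where
  "dist_R d d' =
     (if d = d' then 0
      else if \<exists>\<alpha> \<beta>. comm_line_of_sight d d' \<alpha> \<beta> then ennreal (GREATEST r. r \<in> reciprocals d d')
      else \<infinity>)"

definition slope_dist_R :: "real \<Rightarrow> real \<Rightarrow> ennreal" where
  "slope_dist_R \<alpha> \<gamma> =
     Inf {dist_R d d' | d d'. d \<in> slope_hallways \<alpha> \<and> d' \<in> slope_hallways \<gamma>}"

lemma doorway_eq_iff: "doorway d i = doorway d' i \<longleftrightarrow> d i = d' i"
proof
  assume eq: "doorway d i = doorway d' i"
  have "(of_int (d i) + 1/2, 0) \<in> doorway d i"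
    by (simp add: doorway_def embed_def)
  then have "(of_int (d i) + 1/2, 0) \<in> doorway d' i"
    using eq by simp
  then have "real_of_int (d' i) \<le> of_int (d i) + 1/2" "real_of_int (d i) + 1/2 \<le> of_int (d' i) + 1"
    by (auto simp: doorway_def embed_def)
  then show "d i = d' i" by linarith
qed (simp add: doorway_def)

lemma hallway_eq_iff: "hallway d = hallway d' \<longleftrightarrow> d = d'"
proof
  assume eq: "hallway d = hallway d'"
  have *: "doorway e i = {y. (real i, y) \<notin> hallway e}" for e i
    by (auto simp: hallway_def)
  show "d = d'"
    using doorway_eq_iff[of d _ d'] by (auto simp: * eq)
qed simp

lemma slope_hallways_nonempty: "(\<lambda>i. \<lfloor>\<alpha> * real i\<rfloor>) \<in> slope_hallways \<alpha>"
proof -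
  let ?d = "\<lambda>i. \<lfloor>\<alpha> * real i\<rfloor>"
  have "(0, 1) \<in> proj \<alpha> ` eps_line \<alpha> 0"
    by (rule image_eqI[of _ _ "(0, embed 0 + (0, 1))"])
       (auto simp: proj_def eps_line_def embed_def intro!: exI[of _ 0])
  moreover have "(0, 1) \<notin> proj \<alpha> ` hallway ?d"
  proof
    assume "(0, 1) \<in> proj \<alpha> ` hallway ?d"
    then obtain i y where y: "y \<notin> doorway ?d i" and "(0, 1) = y - embed (\<alpha> * real i)"
      by (auto simp: proj_def hallway_def)
    then have "y = (\<alpha> * real i, 1)"
      by (cases y) (auto simp: embed_def)
    moreover have "of_int \<lfloor>\<alpha> * real i\<rfloor> \<le> \<alpha> * real i" "\<alpha> * real i < of_int \<lfloor>\<alpha> * real i\<rfloor> + 1"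
      by linarith+
    ultimately show False
      using y by (auto simp: doorway_def embed_def)
  qed
  ultimately have "0 \<in> sight \<alpha> 0 (hallway ?d)"
    by (auto simp: sight_def)
  then show ?thesis
    by (auto simp: slope_hallways_def infinite_hallways_def line_of_sight_def)
qed

lemma reciprocals_nonempty:
  assumes "comm_line_of_sight d d' \<alpha> \<beta>"
  shows "reciprocals d d' \<noteq> {}"
proof -
  let ?n = "comm_length d d'"
  define U where "U = insert 1 ((\<lambda>i. of_int (d i) + 1 - (\<alpha> * real i + \<beta>)) ` {..<?n})"
  have U: "finite U" "\<forall>u\<in>U. 0 < u"
    using assms by (auto simp: U_def comm_line_of_sight_def algebra_simps)
  then have pos: "0 < Min U"
    by (subst Min_gr_iff) (auto simp: U_def)
  define \<delta> where "\<delta> = Min U / (real ?n + 1)"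
  have "0 < \<delta>"
    using pos by (simp add: \<delta>_def)
  then obtain r where r: "r \<in> \<rat>" "\<alpha> < r" "r < \<alpha> + \<delta>"
    using Rats_dense_in_real[of \<alpha> "\<alpha> + \<delta>"] by auto
  obtain p q :: int where q: "0 < q" and rq: "r = of_int p / of_int q"
    using r(1) by (metis Rats_cases' of_int_0_less_iff)
  have "unframed_comm_line_of_sight d d' r \<beta>"
    unfolding unframed_comm_line_of_sight_def
  proof (intro allI impI)
    fix i assume i: "i < ?n"
    have "(r - \<alpha>) * real i \<le> \<delta> * (real ?n + 1)"
      using r i \<open>0 < \<delta>\<close> by (intro mult_mono) auto
    also have "\<dots> = Min U"
      by (simp add: \<delta>_def)
    also have "\<dots> \<le> of_int (d i) + 1 - (\<alpha> * real i + \<beta>)"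
      using U i by (intro Min_le) (auto simp: U_def)
    finally have "r * real i + \<beta> \<le> of_int (d i) + 1"
      by (simp add: algebra_simps)
    moreover have "\<alpha> * real i \<le> r * real i"
      using r by (intro mult_right_mono) auto
    moreover have "of_int (d i) < \<alpha> * real i + \<beta>"
      using assms i by (simp add: comm_line_of_sight_def)
    ultimately show "of_int (d i) \<le> r * real i + \<beta> \<and> r * real i + \<beta> \<le> of_int (d i) + 1"
      by linarith
  qed
  then show ?thesis
    using q rq by (auto simp: reciprocals_def)
qed

lemma reciprocals_greatest:
  assumes "comm_line_of_sight d d' \<alpha> \<beta>"
  shows "(GREATEST r. r \<in> reciprocals d d') \<in> reciprocals d d'"
    and "r \<in> reciprocals d d' \<Longrightarrow> r \<le> (GREATEST r. r \<in> reciprocals d d')"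
proof -
  define P where "P k \<longleftrightarrow> 1 / real k \<in> reciprocals d d' \<and> 0 < k" for k :: nat
  have rep: "\<exists>k. P k \<and> r = 1 / real k" if r: "r \<in> reciprocals d d'" for r
  proof -
    obtain q :: int where "0 < q" "r = 1 / of_int q"
      using r by (auto simp: reciprocals_def)
    then have "P (nat q) \<and> r = 1 / real (nat q)"
      using r by (auto simp: P_def)
    then show ?thesis by blast
  qed
  then have "\<exists>k. P k"
    using reciprocals_nonempty[OF assms] by blast
  then have least: "P (LEAST k. P k)"
    by (rule LeastI_ex)
  have ub: "r \<le> 1 / real (LEAST k. P k)" if "r \<in> reciprocals d d'" for r
  proof -
    obtain k where "P k" and r: "r = 1 / real k"
      using rep \<open>r \<in> _\<close> by blast
    then have "(LEAST k. P k) \<le> k"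
      by (simp add: Least_le)
    then show ?thesis
      using least by (simp add: r P_def frac_le)
  qed
  have eq: "(GREATEST r. r \<in> reciprocals d d') = 1 / real (LEAST k. P k)"
    using least ub by (intro Greatest_equality) (auto simp: P_def)
  show "(GREATEST r. r \<in> reciprocals d d') \<in> reciprocals d d'"
    using least by (simp add: eq P_def)
  show "r \<in> reciprocals d d' \<Longrightarrow> r \<le> (GREATEST r. r \<in> reciprocals d d')"
    using ub by (simp add: eq)
qed

end

theory Submission
  imports Defs
begin

text \<open>
  A rational slope \<open>p / q\<close> is isolated from all other slopes, at distance at least \<open>1 / q\<close>. Take
  hallways \<open>d\<close> of slope \<open>\<alpha> \<noteq> p / q\<close> and \<open>d'\<close> of slope \<open>p / q\<close>. A line of sight in the sense of
  \<open>\<real>\<^sup>\<epsilon>\<close> becomes, when its infinitesimal part is dropped, a real line through all the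
  \<^emph>\<open>closed\<close> doorways. Two consequences follow. Such a line stays within distance 1 of the door
  sequence, which therefore determines its slope; so \<open>d \<noteq> d'\<close>. And the real line of slope \<open>p / q\<close>
  obtained from \<open>d'\<close> passes in particular through the closed doorways that \<open>d'\<close> shares with \<open>d\<close>, so
  \<open>1 / q\<close> competes in the maximum that is the distance of \<open>d\<close> and \<open>d'\<close> whenever it is finite. As the bound \<open>1 / q\<close> does
  not depend on the two hallways, it passes to the infimum over them. Irrational slopes all differ
  from \<open>p / q\<close>, hence cannot approach it.
\<close>

text \<open>
  The strict lexicographic inequalities for \<open>a + b\<epsilon>\<close> give only weak inequalities for \<open>a\<close>, which is
  why the doorways have to be closed here.
\<close>

lemma slope_hallways_real_line:
  assumes "d \<in> slope_hallways \<alpha>"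
  obtains \<beta> where "\<And>i. of_int (d i) \<le> \<alpha> * real i + \<beta>" "\<And>i. \<alpha> * real i + \<beta> \<le> of_int (d i) + 1"
proof -
  obtain a b where ab: "(a, b) \<notin> proj \<alpha> ` hallway d"
    using assms by (auto simp: slope_hallways_def line_of_sight_def sight_def)
  have "(\<alpha> * real i + a, b) \<in> doorway d i" for i
  proof (rule ccontr)
    assume "(\<alpha> * real i + a, b) \<notin> doorway d i"
    then have "(real i, (\<alpha> * real i + a, b)) \<in> hallway d"
      by (auto simp: hallway_def)
    moreover have "proj \<alpha> (real i, (\<alpha> * real i + a, b)) = (a, b)"
      by (simp add: proj_def embed_def)
    ultimately show False
      using ab by (metis image_eqI)
  qed
  then have "of_int (d i) \<le> \<alpha> * real i + a \<and> \<alpha> * real i + a \<le> of_int (d i) + 1" for i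
    by (force simp: doorway_def embed_def)
  then show thesis
    using that by blast
qed

text \<open>
  Lines of different slopes drift apart without bound, whereas two lines through the same closed
  doorways of length 1 never differ by more than 1.
\<close>

lemma slope_hallways_slope_unique:
  assumes "d \<in> slope_hallways \<alpha>" "d \<in> slope_hallways \<gamma>"
  shows "\<alpha> = \<gamma>"
proof (rule ccontr)
  assume "\<alpha> \<noteq> \<gamma>"
  obtain \<beta> where \<beta>: "\<And>i. of_int (d i) \<le> \<alpha> * real i + \<beta>" "\<And>i. \<alpha> * real i + \<beta> \<le> of_int (d i) + 1"
    using slope_hallways_real_line[OF assms(1)] by metis
  obtain \<delta> where \<delta>: "\<And>i. of_int (d i) \<le> \<gamma> * real i + \<delta>" "\<And>i. \<gamma> * real i + \<delta> \<le> of_int (d i) + 1"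
    using slope_hallways_real_line[OF assms(2)] by metis
  obtain n :: nat where n: "1 + \<bar>\<beta> - \<delta>\<bar> < real n * \<bar>\<alpha> - \<gamma>\<bar>"
    using reals_Archimedean3[of "\<bar>\<alpha> - \<gamma>\<bar>"] \<open>\<alpha> \<noteq> \<gamma>\<close> by auto
  have "real n * \<bar>\<alpha> - \<gamma>\<bar> = \<bar>\<alpha> * real n - \<gamma> * real n\<bar>"
    by (simp add: abs_mult flip: left_diff_distrib)
  also have "\<dots> \<le> 1 + \<bar>\<beta> - \<delta>\<bar>"
    using \<beta>[of n] \<delta>[of n] by linarith
  finally show False
    using n by simp
qed

lemma dist_R_ge_reciprocal:
  assumes "d \<noteq> d'" "r \<in> reciprocals d d'"
  shows "ennreal r \<le> dist_R d d'"
  using assms by (auto simp: dist_R_def intro!: ennreal_leI reciprocals_greatest(2))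

lemma slope_dist_R_rational_ge:
  fixes p q :: int
  assumes "0 < q" "\<alpha> \<noteq> of_int p / of_int q"
  shows "ennreal (1 / of_int q) \<le> slope_dist_R \<alpha> (of_int p / of_int q)"
  unfolding slope_dist_R_def
proof (rule Inf_greatest, clarify)
  fix d d'
  assume d: "d \<in> slope_hallways \<alpha>" and d': "d' \<in> slope_hallways (of_int p / of_int q)"
  have "d \<noteq> d'"
    using slope_hallways_slope_unique d d' assms(2) by blast
  have shared: "d i = d' i" if "i < comm_length d d'" for i
    using not_less_Least[OF that[unfolded comm_length_def]] by (simp add: doorway_eq_iff)
  obtain \<beta> where "\<And>i. of_int (d' i) \<le> of_int p / of_int q * real i + \<beta>"
      "\<And>i. of_int p / of_int q * real i + \<beta> \<le> of_int (d' i) + 1"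
    using slope_hallways_real_line[OF d'] by metis
  then have "unframed_comm_line_of_sight d d' (of_int p / of_int q) \<beta>"
    by (simp add: unframed_comm_line_of_sight_def shared)
  then have "1 / of_int q \<in> reciprocals d d'"
    using assms(1) by (auto simp: reciprocals_def)
  with \<open>d \<noteq> d'\<close> show "ennreal (1 / of_int q) \<le> dist_R d d'"
    by (rule dist_R_ge_reciprocal)
qed

theorem proposition51:
  fixes x :: "nat \<Rightarrow> real" and y :: real
  assumes "\<And>i. x i \<notin> \<rat>"
    and "(\<lambda>i. slope_dist_R (x i) y) \<longlonglongrightarrow> 0"
  shows "y \<notin> \<rat>"
proof
  assume "y \<in> \<rat>"
  then obtain p q :: int where q: "0 < q" and y: "y = of_int p / of_int q"
    by (metis Rats_cases' of_int_0_less_iff)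
  have "ennreal (1 / of_int q) \<le> slope_dist_R (x i) y" for i
    unfolding y using q assms(1)[of i] \<open>y \<in> \<rat>\<close> y by (intro slope_dist_R_rational_ge) auto
  then have "ennreal (1 / of_int q) \<le> 0"
    by (intro LIMSEQ_le_const[OF assms(2)]) auto
  then show False
    using q by (simp add: ennreal_eq_0_iff)
qed

end
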